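(* Let $p,q$ be complex numbers. The generating function of the odd-indexed $(p,q)$-Pell numbers is, as a formal power series in $z$, $$\sum_{n=0}^{\infty}P_{p,q,2n+1}z^n=\frac{1-qz}{1-2(2p^2+q)z+q^2z^2}.$$
   Context: The $(p,q)$-Pell numbers are defined by $P_{p,q,0}=0$, $P_{p,q,1}=1$, and $P_{p,q,n}=2pP_{p,q,n-1}+qP_{p,q,n-2}$ for $n\ge 2$. *)

theory Defs
  imports "HOL-Computational_Algebra.Formal_Power_Series"
begin

fun pell :: "complex \<Rightarrow> complex \<Rightarrow> nat \<Rightarrow> complex" where
  "pell p q 0 = 0"
| "pell p q (Suc 0) = 1"
| "pell p q (Suc (Suc n)) = 2 * p * pell p q (Suc n) + q * pell p q n"

end

theory Submission
  imports Defs
begin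

text \<open>Taking every second term squares the characteristic roots: the roots of x^2 = 2px + q
  have sum 2p and product -q, so their squares have sum 2(2p^2 + q) and product q^2. This is the
  recurrence \<open>pell_add_4\<close>. Multiplying the series by the denominator therefore kills
  all coefficients from z^2 on, and the initial values leave 1 - qz.\<close>

lemma pell_add_4:
  "pell p q (n + 4) = 2 * (2 * p\<^sup>2 + q) * pell p q (n + 2) - q\<^sup>2 * pell p q n"
proof -
  have "n + 4 = Suc (Suc (Suc (Suc n)))"
    by simp
  then have "pell p q (n + 4) =
      2 * p * (2 * p * pell p q (n + 2) + q * pell p q (Suc n)) + q * pell p q (n + 2)"
    by (simp only: pell.simps add_2_eq_Suc')
  moreover have "pell p q (n + 2) = 2 * p * pell p q (Suc n) + q * pell p q n"
    by simp
  \<comment> \<open>The second equation eliminates the odd-offset term: 2p P(n+1) = P(n+2) - q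
    P(n).\<close>
  ultimately show ?thesis
    by algebra
qed

theorem proposition5:
  fixes p q :: complex
  shows "Abs_fps (\<lambda>n. pell p q (2 * n + 1)) =
    (1 - fps_const q * fps_X) /
    (1 - fps_const (2 * (2 * p\<^sup>2 + q)) * fps_X + fps_const (q\<^sup>2) * fps_X\<^sup>2)"
proof -
  define F where "F = Abs_fps (\<lambda>n. pell p q (2 * n + 1))"
  define c where "c = 2 * (2 * p\<^sup>2 + q)"
  define D where "D = 1 - fps_const c * fps_X + fps_const (q\<^sup>2) * fps_X\<^sup>2"
  have D_nth_0: "fps_nth D 0 = 1"
    by (simp add: D_def)
  have D_nonzero: "D \<noteq> 0"
    using D_nth_0 by auto
  \<comment> \<open>In this form each coefficient of the product is a combination of shifted
    coefficients of \<open>F\<close>.\<close>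
  have FD: "F * D = F - fps_const c * (fps_X * F) + fps_const (q\<^sup>2) * (fps_X\<^sup>2 * F)"
    by (simp add: D_def algebra_simps)
  have "F * D = 1 - fps_const q * fps_X"
  proof (rule fps_ext)
    fix n :: nat
    consider "n = 0" | "n = 1" | m where "n = m + 2"
      by (metis One_nat_def add_2_eq_Suc' not0_implies_Suc)
    then show "fps_nth (F * D) n = fps_nth (1 - fps_const q * fps_X) n"
    proof cases
      case 1
      then show ?thesis
        by (simp add: D_nth_0 F_def)
    next
      case 2
      \<comment> \<open>Here P(3) - c P(1) = (4p^2 + q) - (4p^2 + 2q) = -q.\<close>
      then show ?thesis
        unfolding FD by (simp add: F_def c_def fps_X_power_mult_nth numeral_3_eq_3 power2_eq_square)
    next
      case 3
      \<comment> \<open>Exposes the offsets 4 and 2 from 2m + 1, so that \<open>pell_add_4\<close>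
        applies there.\<close>
      have "2 * n + 1 = (2 * m + 1) + 4" and "2 * (m + 1) + 1 = (2 * m + 1) + 2"
        using 3 by simp_all
      then have "pell p q (2 * n + 1) = c * pell p q (2 * (m + 1) + 1) - q\<^sup>2 * pell p q (2 * m + 1)"
        by (simp only: pell_add_4 c_def)
      with 3 show ?thesis
        unfolding FD by (simp add: F_def fps_X_power_mult_nth del: pell.simps)
    qed
  qed
  then have "F = (1 - fps_const q * fps_X) / D"
    using D_nonzero by (metis nonzero_mult_div_cancel_right)
  then show ?thesis
    by (simp add: F_def D_def c_def)
qed

end
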